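(* Let $r$, $s$ and $t$ be any integers and let $n$ be a non-negative integer. Then $$\sum_{k=0}^n \binom{n}{k} \frac{1}{(k+1)(k+2)} (-1)^{r(n-k)} F_{r}^{k+2} F_s^{n-k} F_{s(k+2)-r(n-k)+t}$$ $$= -\frac{1}{(n+1)(n+2)}\Big( (-1)^{t+1} F_s^{n+1} F_{r+s} F_{r(n+1)-t} - F_t F_{r+s}^{n+2} \Big) + \frac{1}{n+2} F_{s}^{n+1} F_r (-1)^{s+t} F_{r(n+1)-s-t}$$ and $$\sum_{k=0}^n \binom{n}{k} \frac{1}{(k+1)(k+2)} (-1)^{r(n-k)} F_{r}^{k+2} F_s^{n-k} L_{s(k+2)-r(n-k)+t}$$ $$= -\frac{1}{(n+1)(n+2)}\Big( (-1)^{t} F_s^{n+1} F_{r+s} L_{r(n+1)-t} - L_t F_{r+s}^{n+2} \Big) + \frac{1}{n+2} F_{s}^{n+1} F_r (-1)^{s+t+1} L_{r(n+1)-s-t}.$$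
   Context: $F_m$ and $L_m$ denote the Fibonacci and Lucas numbers, defined for all integers $m$ by the recurrence $x_m = x_{m-1}+x_{m-2}$ with $F_0=0$, $F_1=1$ and $L_0=2$, $L_1=1$. In particular $F_{-m}=(-1)^{m-1}F_m$ and $L_{-m}=(-1)^m L_m$. The convention $x^0=1$ (also for $x=0$) is used. *)

theory Defs
  imports Complex_Main "HOL-Number_Theory.Fib"
begin

text \<open>
  Fibonacci and Lucas numbers with arbitrary integer index. The two-sided recurrence
  \<open>x m = x (m - 1) + x (m - 2)\<close> is solved for the leading term at positive indices and
  for the trailing term at negative indices; the lemmas \<open>fibZ_rec\<close> and \<open>lucasZ_rec\<close>
  recover it for every integer \<open>m\<close>.
\<close>

function fibZ :: "int \<Rightarrow> int" where
  "fibZ m = (if m = 0 then 0 else if m = 1 then 1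
             else if m > 1 then fibZ (m - 1) + fibZ (m - 2)
             else fibZ (m + 2) - fibZ (m + 1))"
  by pat_completeness auto
termination
  by (relation "measure (\<lambda>m. if m < 0 then nat (- m) + 2 else nat m)") auto

function lucasZ :: "int \<Rightarrow> int" where
  "lucasZ m = (if m = 0 then 2 else if m = 1 then 1
               else if m > 1 then lucasZ (m - 1) + lucasZ (m - 2)
               else lucasZ (m + 2) - lucasZ (m + 1))"
  by pat_completeness auto
termination
  by (relation "measure (\<lambda>m. if m < 0 then nat (- m) + 2 else nat m)") auto

declare fibZ.simps [simp del] lucasZ.simps [simp del]

lemma fibZ_0 [simp]: "fibZ 0 = 0" and fibZ_1 [simp]: "fibZ 1 = 1"
  by (simp_all add: fibZ.simps)

lemma lucasZ_0 [simp]: "lucasZ 0 = 2" and lucasZ_1 [simp]: "lucasZ 1 = 1"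
  by (simp_all add: lucasZ.simps)

lemma fibZ_rec: "fibZ m = fibZ (m - 1) + fibZ (m - 2)"
proof (cases "m > 1")
  case True
  then show ?thesis by (subst fibZ.simps) simp
next
  case False
  then have "fibZ (m - 2) = fibZ m - fibZ (m - 1)"
    by (subst fibZ.simps) simp
  then show ?thesis by simp
qed

lemma lucasZ_rec: "lucasZ m = lucasZ (m - 1) + lucasZ (m - 2)"
proof (cases "m > 1")
  case True
  then show ?thesis by (subst lucasZ.simps) simp
next
  case False
  then have "lucasZ (m - 2) = lucasZ m - lucasZ (m - 1)"
    by (subst lucasZ.simps) simp
  then show ?thesis by simp
qed

lemma fibZ_of_nat: "fibZ (int n) = int (fib n)"
proof (induction n rule: fib.induct)
  case (3 n)
  then show ?case using fibZ_rec [of "int (Suc (Suc n))"] by (simp add: algebra_simps)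
qed simp_all

lemma fibZ_minus_of_nat: "fibZ (- int n) = (- 1) ^ (n + 1) * fibZ (int n)"
proof (induction n rule: fib.induct)
  case 2
  then show ?case using fibZ_rec [of 1] by simp
next
  case (3 n)
  then show ?case
    using fibZ_rec [of "int (Suc (Suc n))"] fibZ_rec [of "- int n"] minus_diff_commute [of "int n" 1]
    by (simp add: algebra_simps)
qed simp

lemma lucasZ_minus_of_nat: "lucasZ (- int n) = (- 1) ^ n * lucasZ (int n)"
proof (induction n rule: fib.induct)
  case 2
  then show ?case using lucasZ_rec [of 1] by simp
next
  case (3 n)
  then show ?case
    using lucasZ_rec [of "int (Suc (Suc n))"] lucasZ_rec [of "- int n"] minus_diff_commute [of "int n" 1]
    by (simp add: algebra_simps)
qed simp

end

theory Submission
  imports Defs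
begin

text \<open>
  Since \<open>(n choose k) / ((k + 1) * (k + 2)) = ((n + 2) choose (k + 2)) / ((n + 1) * (n + 2))\<close>,
  the sum is a binomial sum of order \<open>n + 2\<close> without its first two terms. The identity
  \<open>F r * G (m + s) + (-1)^r * F s * G (m - r) = F (r + s) * G m\<close>, valid for every solution \<open>G\<close>
  of the Fibonacci recurrence, says that a combination of two shifts acts on \<open>G\<close> as the scalar
  \<open>F (r + s)\<close>; its powers evaluate the complete binomial sum, and applied once more it absorbs
  the term of index 0 together with one of the \<open>n + 2\<close> copies of the term of index 1.
\<close>

section \<open>Two-sided solutions of the Fibonacci recurrence\<close>

definition fibonacci_like :: "(int \<Rightarrow> real) \<Rightarrow> bool" where
  "fibonacci_like G \<longleftrightarrow> (\<forall>m. G m = G (m - 1) + G (m - 2))"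

lemma fibonacci_like_fibZ: "fibonacci_like (\<lambda>m. real_of_int (fibZ m))"
  unfolding fibonacci_like_def by (metis fibZ_rec of_int_add)

lemma fibonacci_like_lucasZ: "fibonacci_like (\<lambda>m. real_of_int (lucasZ m))"
  unfolding fibonacci_like_def by (metis lucasZ_rec of_int_add)

lemma fibonacci_like_shift: "fibonacci_like G \<Longrightarrow> fibonacci_like (\<lambda>m. G (a + m))"
  unfolding fibonacci_like_def by (metis add_diff_eq)

lemma fibonacci_like_lincomb:
  assumes "fibonacci_like G" "fibonacci_like H"
  shows "fibonacci_like (\<lambda>m. a * G m + b * H m)"
  unfolding fibonacci_like_def
proof
  fix m
  have "G m = G (m - 1) + G (m - 2)" "H m = H (m - 1) + H (m - 2)"
    using assms unfolding fibonacci_like_def by blast+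
  then show "a * G m + b * H m
      = a * G (m - 1) + b * H (m - 1) + (a * G (m - 2) + b * H (m - 2))"
    by (simp only: algebra_simps)
qed

lemma minus_one_powi_mult_self: "(-1 :: real) powi m * (-1) powi m = 1"
  by (simp flip: power_int_mult_distrib)

lemma inverse_minus_one_powi: "inverse ((-1 :: real) powi m) = (-1) powi m"
  by (rule inverse_unique) (rule minus_one_powi_mult_self)

text \<open>Reversing the index turns the recurrence into one with a minus sign, which the
  alternating factor undoes.\<close>

lemma fibonacci_like_reflect:
  assumes "fibonacci_like G"
  shows "fibonacci_like (\<lambda>m. (-1) powi m * G (a - m))"
  unfolding fibonacci_like_def
proof
  fix m
  have "G (a - m + 2) = G (a - m + 1) + G (a - m)"
    using assms [unfolded fibonacci_like_def, rule_format, of "a - m + 2"]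
    by (simp add: algebra_simps)
  then show "(-1) powi m * G (a - m)
      = (-1) powi (m - 1) * G (a - (m - 1)) + (-1) powi (m - 2) * G (a - (m - 2))"
    by (simp add: power_int_diff algebra_simps)
qed

lemma fibonacci_like_eqI:
  assumes "fibonacci_like G" "fibonacci_like H" "G 0 = H 0" "G 1 = H 1"
  shows "G m = H m"
proof -
  have rec: "G k = G (k - 1) + G (k - 2)" "H k = H (k - 1) + H (k - 2)" for k
    using assms unfolding fibonacci_like_def by blast+
  \<comment> \<open>With two consecutive values in the induction hypothesis, the recurrence can be
    run both upwards and downwards.\<close>
  have "G m = H m \<and> G (m + 1) = H (m + 1)"
  proof (induction m rule: int_induct [where k = 0])
    case base
    then show ?case using assms by simp
  next
    case (step1 i)
    then show ?case using rec [of "i + 2"] by (simp add: add.commute)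
  next
    case (step2 i)
    then show ?case using rec [of "i + 1"] by simp
  qed
  then show ?thesis by simp
qed

section \<open>Addition, reflection and two-shift identities\<close>

lemma fibZ_minus_one [simp]: "fibZ (- 1) = 1"
  using fibZ_rec [of 1] by simp

lemma lucasZ_minus_one [simp]: "lucasZ (- 1) = - 1"
  using lucasZ_rec [of 1] by simp

text \<open>For fixed \<open>m\<close>, both sides solve the recurrence in \<open>n\<close>, so
  comparing them at \<open>n = 0\<close> and \<open>n = 1\<close> suffices. The same argument,
  applied to the reflected sequence, gives \<open>fibonacci_like_diff\<close>.\<close>

lemma fibonacci_like_add:
  assumes "fibonacci_like G"
  shows "G (m + n) = real_of_int (fibZ (n + 1)) * G m + real_of_int (fibZ n) * G (m - 1)"
proof -
  have G2: "G (m + 1) = G m + G (m - 1)"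
    using assms [unfolded fibonacci_like_def, rule_format, of "m + 1"] by simp
  have F2: "fibZ 2 = 1" using fibZ_rec [of 2] by simp
  have "fibonacci_like (\<lambda>n. G m * real_of_int (fibZ (1 + n)) + G (m - 1) * real_of_int (fibZ n))"
    by (intro fibonacci_like_lincomb fibonacci_like_shift fibonacci_like_fibZ)
  from fibonacci_like_eqI [OF fibonacci_like_shift [OF assms, of m] this, of n] G2 F2
  show ?thesis by (simp add: algebra_simps)
qed

lemma fibonacci_like_diff:
  assumes "fibonacci_like G"
  shows "(-1) powi n * G (m - n)
    = real_of_int (fibZ (n - 1)) * G m - real_of_int (fibZ n) * G (m - 1)"
proof -
  have "fibonacci_like
      (\<lambda>n. G m * real_of_int (fibZ (- 1 + n)) + (- G (m - 1)) * real_of_int (fibZ n))"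
    by (intro fibonacci_like_lincomb fibonacci_like_shift fibonacci_like_fibZ)
  from fibonacci_like_eqI [OF fibonacci_like_reflect [OF assms, of m] this, of n]
  show ?thesis by (simp add: algebra_simps)
qed

lemma fibZ_uminus: "real_of_int (fibZ (- m)) = (-1) powi (m + 1) * real_of_int (fibZ m)"
proof -
  have "(-1) powi (- m) * real_of_int (fibZ m) = - real_of_int (fibZ (- m))"
    using fibonacci_like_diff [OF fibonacci_like_fibZ, of "- m" 0] by simp
  then show ?thesis by (simp add: power_int_add power_int_minus inverse_minus_one_powi)
qed

lemma lucasZ_uminus: "real_of_int (lucasZ (- m)) = (-1) powi m * real_of_int (lucasZ m)"
proof -
  \<comment> \<open>The reflection of the Lucas sequence about 0 again starts with 2, 1, hence is
    the Lucas sequence.\<close>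
  have "(-1) powi (- m) * real_of_int (lucasZ (0 - (- m))) = real_of_int (lucasZ (- m))"
    by (rule fibonacci_like_eqI [OF fibonacci_like_reflect fibonacci_like_lucasZ])
      (simp_all add: fibonacci_like_lucasZ)
  then show ?thesis by (simp add: power_int_minus inverse_minus_one_powi)
qed

text \<open>Expanding both shifts in terms of \<open>G m\<close> and \<open>G (m - 1)\<close>, the
  latter cancels, and the coefficient of \<open>G m\<close> is the addition formula for
  \<open>fibZ (r + s)\<close>.\<close>

lemma fibonacci_like_two_shifts:
  assumes "fibonacci_like G"
  shows "real_of_int (fibZ r) * G (m + s) + (-1) powi r * real_of_int (fibZ s) * G (m - r)
    = real_of_int (fibZ (r + s)) * G m"
proof -
  have "real_of_int (fibZ r) * G (m + s) + (-1) powi r * real_of_int (fibZ s) * G (m - r)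
      = real_of_int (fibZ r) * G (m + s) + real_of_int (fibZ s) * ((-1) powi r * G (m - r))"
    by simp
  also have "\<dots> = real_of_int (fibZ (r + s)) * G m"
    unfolding fibonacci_like_diff [OF assms] fibonacci_like_add [OF assms]
      fibonacci_like_add [OF fibonacci_like_fibZ, of r s]
    by (simp add: algebra_simps)
  finally show ?thesis .
qed

section \<open>Binomial sums\<close>

text \<open>With E the unit shift, the hypothesis says that a E^p + b E^q acts on \<open>G\<close>
  as the scalar \<open>c\<close>. Shifts commute, so the binomial theorem expands the n-th power,
  which acts as \<open>c ^ n\<close>.\<close>

lemma binomial_two_shifts:
  fixes G :: "int \<Rightarrow> real"
  assumes "\<And>m. a * G (m + p) + b * G (m + q) = c * G m"
  shows "(\<Sum>k\<le>n. real (n choose k) * a ^ k * b ^ (n - k) * G (m + int k * p + int (n - k) * q))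
    = c ^ n * G m"
proof (induction n arbitrary: m)
  case 0
  then show ?case by simp
next
  case (Suc n)
  let ?T = "\<lambda>k. a ^ k * b ^ (Suc n - k) * G (m + int k * p + int (Suc n - k) * q)"
  let ?S = "\<lambda>m. \<Sum>k\<le>n. real (n choose k) * a ^ k * b ^ (n - k) * G (m + int k * p + int (n - k) * q)"
  have up: "a * ?S (m + p) = (\<Sum>k\<le>n. real (n choose k) * ?T (Suc k))"
    unfolding sum_distrib_left by (intro sum.cong) (auto simp: algebra_simps)
  have stay: "b * ?S (m + q) = (\<Sum>k\<le>n. real (n choose k) * ?T k)"
    unfolding sum_distrib_left
    by (intro sum.cong) (auto simp: Suc_diff_le algebra_simps)
  \<comment> \<open>Pascal's rule splits every term but the first, which then rejoins the second
    sum; the top term of that sum vanishes because \<open>n choose Suc n\<close> is 0.\<close>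
  have "(\<Sum>k\<le>Suc n. real (Suc n choose k) * ?T k)
      = ?T 0 + (\<Sum>k\<le>n. real (n choose k) * ?T (Suc k)) + (\<Sum>k\<le>n. real (n choose Suc k) * ?T (Suc k))"
    by (simp only: sum.atMost_Suc_shift) (simp add: sum.distrib algebra_simps)
  also have "?T 0 + (\<Sum>k\<le>n. real (n choose k) * ?T (Suc k)) + (\<Sum>k\<le>n. real (n choose Suc k) * ?T (Suc k))
      = (\<Sum>k\<le>n. real (n choose k) * ?T (Suc k)) + (\<Sum>k\<le>Suc n. real (n choose k) * ?T k)"
    by (simp only: sum.atMost_Suc_shift) simp
  also have "\<dots> = a * ?S (m + p) + b * ?S (m + q)"
    unfolding up stay by simp
  also have "\<dots> = c ^ n * (a * G (m + p) + b * G (m + q))"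
    unfolding Suc.IH by (simp add: algebra_simps)
  also have "\<dots> = c ^ Suc n * G m"
    unfolding assms by simp
  finally show ?case by (simp add: mult.assoc)
qed

text \<open>The absorption identity (k+1) C(n+1,k+1) = (n+1) C(n,k), used twice.\<close>

lemma binomial_over_Suc_Suc:
  "real (n choose k) / ((real k + 1) * (real k + 2))
    = real (Suc (Suc n) choose Suc (Suc k)) / ((real n + 1) * (real n + 2))"
proof -
  have "real (Suc (Suc n) choose Suc (Suc k)) * (real k + 2) = (real n + 2) * real (Suc n choose Suc k)"
    using Suc_times_binomial [of "Suc k" "Suc n", THEN arg_cong, of real] by (simp add: algebra_simps)
  moreover have "real (Suc n choose Suc k) * (real k + 1) = (real n + 1) * real (n choose k)"
    using Suc_times_binomial [of k n, THEN arg_cong, of real] by (simp add: algebra_simps)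
  ultimately have "real (Suc (Suc n) choose Suc (Suc k)) * ((real k + 1) * (real k + 2))
      = real (n choose k) * ((real n + 1) * (real n + 2))"
    by (metis (no_types, lifting) mult.assoc mult.commute)
  then show ?thesis
    by (simp add: frac_eq_eq add_nonneg_eq_0_iff)
qed

text \<open>Stated for general \<open>G\<close> to cover both identities at once. The negative
  indices stay unreflected because the reflection sign differs for Fibonacci and Lucas
  numbers.\<close>

lemma fibonacci_like_binomial_sum:
  fixes r s t :: int and n :: nat
  assumes G: "fibonacci_like G"
  shows "(\<Sum>k=0..n. real (n choose k) * (1 / ((real k + 1) * (real k + 2)))
           * (-1) powi (r * (int n - int k))
           * real_of_int (fibZ r) ^ (k + 2) * real_of_int (fibZ s) ^ (n - k)
           * G (s * (int k + 2) - r * (int n - int k) + t))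
       = (real_of_int (fibZ (r + s)) ^ (n + 2) * G t
          - real_of_int (fibZ s) ^ (n + 1) * (-1) powi (r * (int n + 1))
            * (real_of_int (fibZ (r + s)) * G (- (r * (int n + 1) - t))
               + (real n + 1) * real_of_int (fibZ r) * G (- (r * (int n + 1) - s - t))))
         / ((real n + 1) * (real n + 2))"
    (is "?lhs = ?rhs / ?d")
proof -
  define a where "a = real_of_int (fibZ r)"
  define f where "f = real_of_int (fibZ s)"
  define c where "c = real_of_int (fibZ (r + s))"
  define e :: real where "e = (-1) powi r"
  define u where "u = r * (int n + 1)"
  let ?B = "\<lambda>k. a ^ k * (e * f) ^ (n + 2 - k) * G (t + int k * s + int (n + 2 - k) * - r)"
  have two: "a * G (m + s) + (e * f) * G (m + - r) = c * G m" for m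
    using fibonacci_like_two_shifts [OF G, of r m s] by (simp add: a_def f_def c_def e_def)
  have "c ^ (n + 2) * G t = (\<Sum>k\<le>Suc (Suc n). real (Suc (Suc n) choose k) * ?B k)"
    using binomial_two_shifts [of a G s "e * f" "- r" c "n + 2" t, OF two] by (simp only: mult.assoc add_2_eq_Suc')
  also have "\<dots> = ?B 0 + (real n + 2) * ?B 1
      + (\<Sum>k\<le>n. real (Suc (Suc n) choose Suc (Suc k)) * ?B (k + 2))"
    by (simp only: sum.atMost_Suc_shift) simp
  finally have full: "(\<Sum>k\<le>n. real (Suc (Suc n) choose Suc (Suc k)) * ?B (k + 2))
      = c ^ (n + 2) * G t - ?B 0 - (real n + 2) * ?B 1" by simp
  have e_pow: "e ^ k = (-1) powi (r * int k)" for k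
    by (simp add: e_def power_int_mult)
  \<comment> \<open>One of the \<open>n + 2\<close> factors \<open>e * f\<close> is kept apart, so
    that this term and \<open>?B 1\<close> share a prefactor and fit \<open>two\<close> at
    \<open>- (u - t)\<close>.\<close>
  have B0: "?B 0 = f ^ (n + 1) * (-1) powi u * (e * f * G (- (u - t) + - r))"
  proof -
    have "t + int 0 * s + int (n + 2 - 0) * - r = - (u - t) + - r"
      by (simp add: u_def algebra_simps)
    moreover have "(e * f) ^ (n + 2 - 0) = f ^ (n + 1) * (-1) powi u * (e * f)"
      using e_pow [of "n + 1"] by (simp add: u_def power_mult_distrib algebra_simps)
    ultimately show ?thesis by (simp only: power_0 mult_1_left mult.assoc)
  qed
  have B1: "?B 1 = f ^ (n + 1) * (-1) powi u * (a * G (- (u - t) + s))"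
  proof -
    have "t + int 1 * s + int (n + 2 - 1) * - r = - (u - t) + s"
      by (simp add: u_def algebra_simps)
    moreover have "(e * f) ^ (n + 2 - 1) = f ^ (n + 1) * (-1) powi u"
      using e_pow [of "n + 1"] by (simp add: u_def power_mult_distrib algebra_simps)
    ultimately show ?thesis by (simp only: power_one_right mult_ac)
  qed
  have summand: "real (n choose k) * (1 / ((real k + 1) * (real k + 2)))
           * (-1) powi (r * (int n - int k)) * a ^ (k + 2) * f ^ (n - k)
           * G (s * (int k + 2) - r * (int n - int k) + t)
        = real (Suc (Suc n) choose Suc (Suc k)) * ?B (k + 2) / ?d" if "k \<le> n" for k
  proof -
    have "(e * f) ^ (n + 2 - (k + 2)) = (-1) powi (r * (int n - int k)) * f ^ (n - k)"
      using that by (simp add: power_mult_distrib e_pow of_nat_diff)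
    moreover have "t + int (k + 2) * s + int (n + 2 - (k + 2)) * - r
        = s * (int k + 2) - r * (int n - int k) + t"
      using that by (simp add: of_nat_diff algebra_simps)
    moreover have "real (n choose k) * (1 / ((real k + 1) * (real k + 2)))
        = real (Suc (Suc n) choose Suc (Suc k)) / ?d"
      using binomial_over_Suc_Suc [of n k] by simp
    ultimately show ?thesis by (simp only: times_divide_eq_left times_divide_eq_right mult_ac)
  qed
  have "?lhs = (\<Sum>k\<le>n. real (Suc (Suc n) choose Suc (Suc k)) * ?B (k + 2)) / ?d"
    unfolding atLeast0AtMost sum_divide_distrib a_def [symmetric] f_def [symmetric]
    by (intro sum.cong refl summand) simp
  \<comment> \<open>One copy of \<open>?B 1\<close> merges with \<open>?B 0\<close> through
    \<open>two\<close>, which leaves \<open>n + 1\<close> copies.\<close>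
  also have "(\<Sum>k\<le>n. real (Suc (Suc n) choose Suc (Suc k)) * ?B (k + 2))
      = c ^ (n + 2) * G t - f ^ (n + 1) * (-1) powi u
          * (c * G (- (u - t)) + (real n + 1) * a * G (- (u - t) + s))"
    unfolding full B0 B1 two [symmetric, of "- (u - t)"] by (simp add: algebra_simps)
  also have "\<dots> = ?rhs"
    by (simp add: a_def f_def c_def u_def algebra_simps)
  finally show ?thesis .
qed

theorem theorem14:
  fixes r s t :: int and n :: nat
  shows "((\<Sum>k=0..n. real (n choose k) * (1 / ((real k + 1) * (real k + 2)))
           * (-1) powi (r * (int n - int k))
           * real_of_int (fibZ r) ^ (k + 2) * real_of_int (fibZ s) ^ (n - k)
           * real_of_int (fibZ (s * (int k + 2) - r * (int n - int k) + t)))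
       = - (1 / ((real n + 1) * (real n + 2)))
           * ((-1) powi (t + 1) * real_of_int (fibZ s) ^ (n + 1) * real_of_int (fibZ (r + s))
                * real_of_int (fibZ (r * (int n + 1) - t))
              - real_of_int (fibZ t) * real_of_int (fibZ (r + s)) ^ (n + 2))
         + 1 / (real n + 2) * real_of_int (fibZ s) ^ (n + 1) * real_of_int (fibZ r)
             * (-1) powi (s + t) * real_of_int (fibZ (r * (int n + 1) - s - t)))
    \<and> ((\<Sum>k=0..n. real (n choose k) * (1 / ((real k + 1) * (real k + 2)))
           * (-1) powi (r * (int n - int k))
           * real_of_int (fibZ r) ^ (k + 2) * real_of_int (fibZ s) ^ (n - k)
           * real_of_int (lucasZ (s * (int k + 2) - r * (int n - int k) + t)))
       = - (1 / ((real n + 1) * (real n + 2)))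
           * ((-1) powi t * real_of_int (fibZ s) ^ (n + 1) * real_of_int (fibZ (r + s))
                * real_of_int (lucasZ (r * (int n + 1) - t))
              - real_of_int (lucasZ t) * real_of_int (fibZ (r + s)) ^ (n + 2))
         + 1 / (real n + 2) * real_of_int (fibZ s) ^ (n + 1) * real_of_int (fibZ r)
             * (-1) powi (s + t + 1) * real_of_int (lucasZ (r * (int n + 1) - s - t)))"
proof -
  define A where "A = r * (int n + 1)"
  \<comment> \<open>The sign with exponent \<open>A\<close> is its own inverse, so it removes
    \<open>A\<close> from the reflection sign.\<close>
  have flip: "(-1) powi A * (-1) powi (A - j) = ((-1) powi j :: real)"
    "(-1) powi A * (-1) powi (A - j + 1) = ((-1) powi (j + 1) :: real)" for j
    using minus_one_powi_mult_self [of A] by (simp_all add: power_int_diff power_int_add divide_inverse inverse_minus_one_powi)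
  have fib: "(-1) powi A * real_of_int (fibZ (- (A - j)))
      = (-1) powi (j + 1) * real_of_int (fibZ (A - j))" for j
    unfolding fibZ_uminus mult.assoc [symmetric] flip ..
  have lucas: "(-1) powi A * real_of_int (lucasZ (- (A - j)))
      = (-1) powi j * real_of_int (lucasZ (A - j))" for j
    unfolding lucasZ_uminus mult.assoc [symmetric] flip ..
  \<comment> \<open>Both identities share this algebra and differ only in the signs \<open>p\<close>
    and \<open>q\<close>. The factor \<open>real n + 1\<close> cancels in the \<open>y\<close> term,
    leaving the denominator \<open>real n + 2\<close>.\<close>
  have rearrange: "(c ^ (n + 2) * g - f ^ (n + 1) * e * (c * x + (real n + 1) * a * y))
        / ((real n + 1) * (real n + 2))
      = - (1 / ((real n + 1) * (real n + 2))) * (p * f ^ (n + 1) * c * X - g * c ^ (n + 2))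
        + 1 / (real n + 2) * f ^ (n + 1) * a * q * Y"
    if "e * x = p * X" "e * y = - (q * Y)" for a c e f g p q x y X Y :: real
  proof -
    have "f ^ (n + 1) * e * (c * x + (real n + 1) * a * y)
        = f ^ (n + 1) * (c * (e * x) + (real n + 1) * a * (e * y))"
      by (simp add: algebra_simps)
    moreover have "1 / (real n + 2) = (real n + 1) / ((real n + 1) * (real n + 2))"
      by simp
    ultimately show ?thesis
      unfolding that by (simp only:) (simp add: diff_divide_distrib add_divide_distrib algebra_simps)
  qed
  have st: "A - s - t = A - (s + t)" by simp
  have succ: "(-1 :: real) powi (i + 1) = - ((-1) powi i)" for i
    by (simp add: power_int_add)
  show ?thesis
    unfolding fibonacci_like_binomial_sum [OF fibonacci_like_fibZ]
      fibonacci_like_binomial_sum [OF fibonacci_like_lucasZ] A_def [symmetric] st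
    by (intro conjI rearrange) (simp_all only: fib lucas, simp_all add: succ)
qed

end
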